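(* Every non-Abelian finite simple group is AAS.
   Context: For a finite group $G$ with identity $e_G$, the order set is $\mathcal{O}(G)=\{|x| : x\in G\setminus\{e_G\}\}=\{n_1<n_2<\dots<n_r\}$. Commutators are $[g_1,g_2]=g_1^{-1}g_2^{-1}g_1g_2$. A tuple $(h;[n_1,t_1],\dots,[n_r,t_r])$ with integers $h\ge 0$, $t_i\ge 0$ abbreviates $(h;m_1,\dots,m_s)$, where the tail $m_1,\dots,m_s$ consists of $t_i$ copies of $n_i$ for each $i$ (so $s=\sum t_i$). It is a potential signature for $G$ if it satisfies the Riemann--Hurwitz formula $g=1+|G|(h-1)+\frac{|G|}{2}\sum_{j=1}^s\left(1-\frac1{m_j}\right)$ for some integer $g\ge 2$; the set of potential signatures is $\mathcal{P}_G$. An $(h;m_1,\dots,m_s)$-generating vector for $G$ is a vector $(a_1,b_1,\dots,a_h,b_h,c_1,\dots,c_s)$ of elements of $G$ such that (a) these elements generate $G$, (b) $c_j$ has order $m_j$ for each $j$, and (c) $\prod_{i=1}^h[a_i,b_i]\prod_{j=1}^s c_j=e_G$. A potential signature is an actual signature for $G$ if a corresponding generating vector for $G$ exists; the set of actual signatures is $\mathcal{A}_G\subseteq\mathcal{P}_G$. The group $G$ is AAS (acts with almost all signatures) if $\mathcal{P}_G\setminus\mathcal{A}_G$ is finite. *)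

theory Defs
  imports
    Complex_Main
    "HOL-Algebra.SimpleGroups"
    "HOL-Algebra.Generated_Groups"
    "HOL-Algebra.Multiplicative_Group"
begin

definition order_set :: "('a, 'b) monoid_scheme \<Rightarrow> nat set"
  where "order_set G = group.ord G ` (carrier G - {\<one>\<^bsub>G\<^esub>})"

text \<open>The increasing enumeration \<open>n\<^sub>1 < \<dots> < n\<^sub>r\<close> of the order set
  (meaningful for finite \<open>G\<close>).\<close>

definition order_list :: "('a, 'b) monoid_scheme \<Rightarrow> nat list"
  where "order_list G = sorted_list_of_set (order_set G)"

definition commutator :: "('a, 'b) monoid_scheme \<Rightarrow> 'a \<Rightarrow> 'a \<Rightarrow> 'a"
  where "commutator G x y = inv\<^bsub>G\<^esub> x \<otimes>\<^bsub>G\<^esub> inv\<^bsub>G\<^esub> y \<otimes>\<^bsub>G\<^esub> x \<otimes>\<^bsub>G\<^esub> y"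

definition list_product :: "('a, 'b) monoid_scheme \<Rightarrow> 'a list \<Rightarrow> 'a"
  where "list_product G xs = foldr (\<lambda>x y. x \<otimes>\<^bsub>G\<^esub> y) xs \<one>\<^bsub>G\<^esub>"

text \<open>A signature \<open>(h; m\<^sub>1, \<dots>, m\<^sub>s)\<close> is the pair of \<open>h\<close> and the list
  \<open>[m\<^sub>1, \<dots>, m\<^sub>s]\<close>. The abbreviated form \<open>(h; [n\<^sub>1,t\<^sub>1], \<dots>, [n\<^sub>r,t\<^sub>r])\<close> is given by
  the list \<open>[t\<^sub>1, \<dots>, t\<^sub>r]\<close> of multiplicities, which are allowed to be zero.\<close>

type_synonym signature = "nat \<times> nat list"

definition signature_tail :: "('a, 'b) monoid_scheme \<Rightarrow> nat list \<Rightarrow> nat list"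
  where "signature_tail G ts = concat (map2 (\<lambda>n t. replicate t n) (order_list G) ts)"

definition riemann_hurwitz :: "('a, 'b) monoid_scheme \<Rightarrow> int \<Rightarrow> signature \<Rightarrow> bool"
  where "riemann_hurwitz G g = (\<lambda>(h, ms).
    real_of_int g = 1 + real (order G) * (real h - 1)
      + real (order G) / 2 * (\<Sum>m\<leftarrow>ms. 1 - 1 / real m))"

definition potential_signatures :: "('a, 'b) monoid_scheme \<Rightarrow> signature set"
  where "potential_signatures G =
    {(h, signature_tail G ts) | h ts.
      length ts = length (order_list G) \<and>
      (\<exists>g\<ge>2. riemann_hurwitz G g (h, signature_tail G ts))}"

text \<open>The vector \<open>(a\<^sub>1, b\<^sub>1, \<dots>, a\<^sub>h, b\<^sub>h, c\<^sub>1, \<dots>, c\<^sub>s)\<close> is given as the list of the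
  pairs \<open>(a\<^sub>i, b\<^sub>i)\<close> together with the list of the \<open>c\<^sub>j\<close>.\<close>

definition generating_vector ::
    "('a, 'b) monoid_scheme \<Rightarrow> signature \<Rightarrow> ('a \<times> 'a) list \<Rightarrow> 'a list \<Rightarrow> bool"
  where "generating_vector G = (\<lambda>(h, ms) abps cs.
    length abps = h \<and> length cs = length ms \<and>
    set abps \<subseteq> carrier G \<times> carrier G \<and> set cs \<subseteq> carrier G \<and>
    generate G (fst ` set abps \<union> snd ` set abps \<union> set cs) = carrier G \<and>
    (\<forall>j<length ms. group.ord G (cs ! j) = ms ! j) \<and>
    list_product G (map (\<lambda>(a, b). commutator G a b) abps) \<otimes>\<^bsub>G\<^esub> list_product G cs = \<one>\<^bsub>G\<^esub>)"

definition actual_signatures :: "('a, 'b) monoid_scheme \<Rightarrow> signature set"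
  where "actual_signatures G =
    {\<sigma> \<in> potential_signatures G. \<exists>abps cs. generating_vector G \<sigma> abps cs}"

definition AAS :: "('a, 'b) monoid_scheme \<Rightarrow> bool"
  where "AAS G \<longleftrightarrow> finite (potential_signatures G - actual_signatures G)"

end

theory Submission
  imports Defs
begin

text \<open>
  The set \<open>C\<close> of all elements of a given order \<open>n\<close> is closed under conjugation, and so is
  \<open>C\<^sup>-\<^sup>1C\<close>. As \<open>G\<close> is simple and non-Abelian, \<open>C\<^sup>-\<^sup>1C\<close> generates \<open>G\<close>; it contains the identity, so
  some power of it is all of \<open>G\<close>. Inverses being positive powers, it follows that for all large \<open>t\<close>
  every element of \<open>G\<close> is a product of exactly \<open>t\<close> elements of \<open>C\<close>, and one may prescribe an
  initial segment that runs through \<open>C\<close> and hence generates \<open>G\<close>. In the same way, for all large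
  \<open>h\<close> every element is a product of \<open>h\<close> commutators of pairs that generate \<open>G\<close>. So as soon as \<open>h\<close> or
  some \<open>t\<^sub>i\<close> is large, the remaining entries of a generating vector can be chosen arbitrarily.
\<close>

section \<open>Products of lists and generation without inverses\<close>

lemma list_product_Nil [simp]: "list_product G [] = \<one>\<^bsub>G\<^esub>"
  by (simp add: list_product_def)

lemma list_product_Cons [simp]: "list_product G (x # xs) = x \<otimes>\<^bsub>G\<^esub> list_product G xs"
  by (simp add: list_product_def)

context group
begin

lemma list_product_closed [simp]: "set xs \<subseteq> carrier G \<Longrightarrow> list_product G xs \<in> carrier G"
  by (induction xs) auto

lemma list_product_append:
  assumes "set xs \<subseteq> carrier G" "set ys \<subseteq> carrier G"
  shows "list_product G (xs @ ys) = list_product G xs \<otimes> list_product G ys"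
  using assms by (induction xs) (auto simp: m_assoc)

lemma list_product_replicate:
  "x \<in> carrier G \<Longrightarrow> list_product G (replicate n x) = x [^] n"
proof (induction n)
  case (Suc n)
  then show ?case using nat_pow_Suc2[of x n] by simp
qed simp

lemma list_product_replicate_one_append:
  "set xs \<subseteq> carrier G \<Longrightarrow> list_product G (replicate n \<one> @ xs) = list_product G xs"
  by (subst list_product_append) (auto simp: list_product_replicate)

text \<open>Lagrange gives \<open>x [^] order G = \<one>\<close>. The exponent is taken from
  \<open>order G\<close> rather than \<open>ord x\<close> so that it is the same for all elements;
  lengths of products can then be controlled uniformly.\<close>

lemma finite_inv_eq_pow:
  assumes "finite (carrier G)" "x \<in> carrier G"
  shows "inv x = x [^] (order G - 1)"
proof -
  have "order G > 0"
    using assms(1) order_gt_0_iff_finite by blast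
  then have "x [^] (order G - 1) \<otimes> x = \<one>"
    using pow_order_eq_1[OF assms(2)] by (metis Suc_diff_1 nat_pow_Suc)
  then show ?thesis
    using assms(2) by (simp add: inv_equality)
qed

text \<open>Inverses of members of \<open>S\<close> are rewritten as positive powers, so finiteness
  lets words in \<open>S\<close> alone reach the whole generated subgroup.\<close>

lemma generate_as_list_product:
  assumes "finite (carrier G)" "S \<subseteq> carrier G" "g \<in> generate G S"
  shows "\<exists>xs. set xs \<subseteq> S \<and> list_product G xs = g"
  using assms(3)
proof induction
  case one
  show ?case by (rule exI[of _ "[]"]) simp
next
  case (incl h)
  then show ?case using assms(2) by (intro exI[of _ "[h]"]) auto
next
  case (inv h)
  then show ?case
    using assms(1,2)
    by (intro exI[of _ "replicate (order G - 1) h"])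
       (auto simp: list_product_replicate finite_inv_eq_pow subset_iff)
next
  case (eng h1 h2)
  then obtain xs ys where "set xs \<subseteq> S" "list_product G xs = h1"
    "set ys \<subseteq> S" "list_product G ys = h2" by blast
  then show ?case
    using assms(2) by (intro exI[of _ "xs @ ys"]) (auto simp: list_product_append)
qed

text \<open>A word for \<open>g\<close> can be padded with copies of \<open>\<one>\<close> to any
  greater length. As there are finitely many \<open>g\<close>, one threshold serves all of
  them.\<close>

lemma eventually_cover_if_one_mem:
  assumes fin: "finite (carrier G)" and S: "S \<subseteq> carrier G" "\<one> \<in> S" "generate G S = carrier G"
  shows "\<forall>\<^sub>F t in sequentially. \<forall>g\<in>carrier G. \<exists>xs. length xs = t \<and> set xs \<subseteq> S \<and> list_product G xs = g"
proof (intro eventually_ball_finite[OF fin] ballI)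
  fix g assume "g \<in> carrier G"
  then obtain xs where xs: "set xs \<subseteq> S" "list_product G xs = g"
    using generate_as_list_product[OF fin S(1)] S(3) by blast
  show "\<forall>\<^sub>F t in sequentially. \<exists>xs. length xs = t \<and> set xs \<subseteq> S \<and> list_product G xs = g"
    using eventually_ge_at_top[of "length xs"]
  proof eventually_elim
    case (elim t)
    then show ?case
      using xs S list_product_replicate_one_append[of xs "t - length xs"]
      by (intro exI[of _ "replicate (t - length xs) \<one> @ xs"]) auto
  qed
qed

section \<open>Conjugation, orders and commutators\<close>

lemma conj_mult:
  assumes "x \<in> carrier G" "y \<in> carrier G" "g \<in> carrier G"
  shows "g \<otimes> (x \<otimes> y) \<otimes> inv g = (g \<otimes> x \<otimes> inv g) \<otimes> (g \<otimes> y \<otimes> inv g)"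
proof -
  have "inv g \<otimes> (g \<otimes> z) = z" if "z \<in> carrier G" for z
    using that assms by (simp add: m_assoc[symmetric])
  then show ?thesis
    using assms by (simp add: m_assoc)
qed

lemma conj_inv:
  assumes "x \<in> carrier G" "g \<in> carrier G"
  shows "g \<otimes> inv x \<otimes> inv g = inv (g \<otimes> x \<otimes> inv g)"
  using assms by (simp add: inv_mult_group m_assoc)

lemma conj_pow:
  assumes "x \<in> carrier G" "g \<in> carrier G"
  shows "g \<otimes> x [^] (n::nat) \<otimes> inv g = (g \<otimes> x \<otimes> inv g) [^] n"
  using assms by (induction n) (auto simp: conj_mult)

lemma conj_eq_one_iff:
  assumes "x \<in> carrier G" "g \<in> carrier G"
  shows "g \<otimes> x \<otimes> inv g = \<one> \<longleftrightarrow> x = \<one>"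
  using assms by (metis inv_closed inv_equality inv_inv l_cancel_one' m_assoc m_closed r_inv r_one)

text \<open>Conjugation commutes with powers and fixes only the identity to the identity, so
  \<open>x\<close> and its conjugate are annihilated by the same exponents.\<close>

lemma ord_conj:
  assumes "x \<in> carrier G" "g \<in> carrier G"
  shows "ord (g \<otimes> x \<otimes> inv g) = ord x"
proof -
  have "(g \<otimes> x \<otimes> inv g) [^] n = \<one> \<longleftrightarrow> x [^] n = \<one>" for n :: nat
    using assms by (simp add: conj_eq_one_iff flip: conj_pow)
  then have "ord (g \<otimes> x \<otimes> inv g) dvd n \<longleftrightarrow> ord x dvd n" for n
    using assms by (simp add: pow_eq_id)
  then show ?thesis
    by (meson dvd_antisym dvd_refl)
qed

lemma commutator_closed [simp]:
  "x \<in> carrier G \<Longrightarrow> y \<in> carrier G \<Longrightarrow> commutator G x y \<in> carrier G"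
  by (simp add: commutator_def)

lemma conj_commutator:
  assumes "x \<in> carrier G" "y \<in> carrier G" "g \<in> carrier G"
  shows "g \<otimes> commutator G x y \<otimes> inv g = commutator G (g \<otimes> x \<otimes> inv g) (g \<otimes> y \<otimes> inv g)"
  using assms by (simp add: commutator_def conj_mult conj_inv)

lemma commutator_one_right: "x \<in> carrier G \<Longrightarrow> commutator G x \<one> = \<one>"
  by (simp add: commutator_def)

lemma commutator_eq_oneD:
  assumes "x \<in> carrier G" "y \<in> carrier G" "commutator G x y = \<one>"
  shows "x \<otimes> y = y \<otimes> x"
proof -
  have "inv (y \<otimes> x) \<otimes> (x \<otimes> y) = \<one>"
    using assms by (simp add: commutator_def inv_mult_group m_assoc)
  then show ?thesis
    using assms by (metis inv_closed inv_equality inv_inv m_closed)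
qed

text \<open>This excludes a conjugation-closed generating set with a single element in the
  non-Abelian case.\<close>

lemma comm_group_if_generate_singleton:
  assumes "x \<in> carrier G" "generate G {x} = carrier G"
  shows "comm_group G"
proof (rule group_comm_groupI)
  fix a b assume "a \<in> carrier G" "b \<in> carrier G"
  then obtain i j :: int where "a = x [^] i" "b = x [^] j"
    using assms generate_pow[OF assms(1)] by blast
  then show "a \<otimes> b = b \<otimes> a"
    using assms(1) by (simp add: int_pow_mult[symmetric] add.commute)
qed

end

section \<open>Covering a simple group by products of prescribed length\<close>

context simple_group
begin

text \<open>A conjugation-closed set generates a normal subgroup, which by simplicity is trivial or
  everything.\<close>

lemma generate_conj_closed:
  assumes "S \<subseteq> carrier G" "\<And>x g. x \<in> S \<Longrightarrow> g \<in> carrier G \<Longrightarrow> g \<otimes> x \<otimes> inv g \<in> S"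
    and "\<not> S \<subseteq> {\<one>}"
  shows "generate G S = carrier G"
  using no_real_normal_subgroup[OF normal_generateI[OF assms(1,2)]] assms(3)
  by (blast intro: generate.incl)

lemma eventually_conj_closed_cover:
  assumes fin: "finite (carrier G)" and ncomm: "\<not> comm_group G"
    and S: "S \<subseteq> carrier G" and conj: "\<And>x g. x \<in> S \<Longrightarrow> g \<in> carrier G \<Longrightarrow> g \<otimes> x \<otimes> inv g \<in> S"
    and "\<not> S \<subseteq> {\<one>}"
  shows "\<forall>\<^sub>F t in sequentially. \<forall>g\<in>carrier G. \<exists>xs. length xs = t \<and> set xs \<subseteq> S \<and> list_product G xs = g"
proof -
  obtain c where c: "c \<in> S" "c \<noteq> \<one>"
    using assms(5) by blast
  define D where "D = {inv x \<otimes> y | x y. x \<in> S \<and> y \<in> S}"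
  have D: "D \<subseteq> carrier G" "\<one> \<in> D"
    using S c unfolding D_def by (auto intro!: exI[of _ c])
  have "generate G D = carrier G"
  proof (rule generate_conj_closed[OF D(1)])
    fix z g assume "z \<in> D" "g \<in> carrier G"
    then obtain x y where "z = inv x \<otimes> y" "x \<in> S" "y \<in> S"
      unfolding D_def by blast
    moreover from this have "g \<otimes> z \<otimes> inv g = inv (g \<otimes> x \<otimes> inv g) \<otimes> (g \<otimes> y \<otimes> inv g)"
      using S \<open>g \<in> carrier G\<close> by (auto simp: conj_mult conj_inv subset_iff)
    ultimately show "g \<otimes> z \<otimes> inv g \<in> D"
      unfolding D_def using conj \<open>g \<in> carrier G\<close> by blast
  next
    \<comment> \<open>If all quotients were trivial, \<open>S\<close> would be the singleton
      \<open>{c}\<close>, and \<open>c\<close> alone would generate \<open>G\<close>, making it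
      cyclic.\<close>
    show "\<not> D \<subseteq> {\<one>}"
    proof
      assume "D \<subseteq> {\<one>}"
      then have "inv c \<otimes> y = \<one>" if "y \<in> S" for y
        using that c unfolding D_def by blast
      then have "y = c" if "y \<in> S" for y
        using inv_equality[of "inv c" y] that S c by (metis inv_closed inv_inv subsetD)
      then have "S = {c}"
        using c by blast
      then show False
        using generate_conj_closed[OF S conj assms(5)] comm_group_if_generate_singleton S ncomm
        by auto
    qed
  qed
  from eventually_cover_if_one_mem[OF fin D this]
  obtain k where k: "\<And>g. g \<in> carrier G \<Longrightarrow> \<exists>xs. length xs = k \<and> set xs \<subseteq> D \<and> list_product G xs = g"
    unfolding eventually_sequentially by blast
  have order_pos: "order G > 0"
    using fin order_gt_0_iff_finite by blast
  \<comment> \<open>Each factor \<open>inv x \<otimes> y\<close> becomes \<open>order G - 1\<close>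
    copies of \<open>x\<close> followed by \<open>y\<close>. That is exactly \<open>order G\<close>
    elements of \<open>S\<close> whatever the factor is.\<close>
  have expand: "\<exists>ys. length ys = order G * length xs \<and> set ys \<subseteq> S \<and> list_product G ys = list_product G xs"
    if "set xs \<subseteq> D" for xs
    using that
  proof (induction xs)
    case (Cons d xs)
    then obtain ys where ys: "length ys = order G * length xs" "set ys \<subseteq> S"
        "list_product G ys = list_product G xs"
      by auto
    obtain x y where xy: "d = inv x \<otimes> y" "x \<in> S" "y \<in> S"
      using Cons.prems unfolding D_def by auto
    have carr: "x \<in> carrier G" "y \<in> carrier G" "set ys \<subseteq> carrier G"
      using xy ys S by auto
    have "list_product G (replicate (order G - 1) x @ y # ys) = d \<otimes> list_product G xs"
      using xy(1) ys(3) carr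
      by (subst list_product_append)
         (auto simp: list_product_replicate finite_inv_eq_pow[OF fin] m_assoc subset_iff
           simp flip: ys(3))
    then show ?case
      using xy ys order_pos by (intro exI[of _ "replicate (order G - 1) x @ y # ys"]) auto
  qed simp
  show ?thesis
    using eventually_ge_at_top[of "order G * k"]
  proof eventually_elim
    case (elim t)
    show ?case
    proof
      fix g assume g: "g \<in> carrier G"
      \<comment> \<open>Copies of \<open>c\<close> take up the length beyond
        \<open>order G * k\<close>; the word \<open>ys\<close> below is chosen to cancel their
        product.\<close>
      define cs where "cs = replicate (t - order G * k) c"
      have cs: "set cs \<subseteq> S" "set cs \<subseteq> carrier G"
        using c S by (auto simp: cs_def)
      obtain xs where "length xs = k" "set xs \<subseteq> D" "list_product G xs = inv (list_product G cs) \<otimes> g"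
        using k[of "inv (list_product G cs) \<otimes> g"] g cs by auto
      with expand[of xs] obtain ys where ys: "length ys = order G * k" "set ys \<subseteq> S"
          "list_product G ys = inv (list_product G cs) \<otimes> g"
        by auto
      have "list_product G (cs @ ys) = g"
        using ys cs S g by (subst list_product_append) (auto simp: m_assoc[symmetric])
      then show "\<exists>xs. length xs = t \<and> set xs \<subseteq> S \<and> list_product G xs = g"
        using ys cs elim by (intro exI[of _ "cs @ ys"]) (auto simp: cs_def)
    qed
  qed
qed

lemma eventually_generating_elements_of_order:
  assumes fin: "finite (carrier G)" and ncomm: "\<not> comm_group G" and n: "n \<in> order_set G"
  shows "\<forall>\<^sub>F t in sequentially. \<forall>g\<in>carrier G. \<exists>cs. set cs \<subseteq> carrier G \<and> map ord cs = replicate t n \<and>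
    generate G (set cs) = carrier G \<and> list_product G cs = g"
proof -
  define S where "S = {x \<in> carrier G. ord x = n}"
  have S: "S \<subseteq> carrier G" "\<not> S \<subseteq> {\<one>}"
    using n by (auto simp: S_def order_set_def)
  have conj: "g \<otimes> x \<otimes> inv g \<in> S" if "x \<in> S" "g \<in> carrier G" for x g
    using that by (simp add: S_def ord_conj)
  \<comment> \<open>The enumeration \<open>zs\<close> of \<open>S\<close> will be an initial segment
    that ensures generation; the remaining entries, at least \<open>k\<close> of them, correct the
    product.\<close>
  obtain zs where zs: "set zs = S"
    using finite_list finite_subset[OF S(1) fin] by blast
  obtain k where k: "\<And>t g. t \<ge> k \<Longrightarrow> g \<in> carrier G \<Longrightarrow>
      \<exists>xs. length xs = t \<and> set xs \<subseteq> S \<and> list_product G xs = g"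
    using eventually_conj_closed_cover[OF fin ncomm S(1) conj S(2)]
    unfolding eventually_sequentially by blast
  show ?thesis
    using eventually_ge_at_top[of "length zs + k"]
  proof (eventually_elim, intro ballI)
    fix t g assume t: "length zs + k \<le> t" and g: "g \<in> carrier G"
    have "k \<le> t - length zs" "inv (list_product G zs) \<otimes> g \<in> carrier G"
      using t g S(1) zs by auto
    then obtain xs where xs: "length xs = t - length zs" "set xs \<subseteq> S"
        "list_product G xs = inv (list_product G zs) \<otimes> g"
      using k by blast
    have set: "set (zs @ xs) = S"
      using xs zs by auto
    have "list_product G (zs @ xs) = g"
      using xs zs S(1) g by (subst list_product_append) (auto simp: m_assoc[symmetric])
    moreover have "map ord (zs @ xs) = replicate t n"
      using set t xs(1) by (intro replicate_eqI) (auto simp: S_def)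
    ultimately show "\<exists>cs. set cs \<subseteq> carrier G \<and> map ord cs = replicate t n \<and>
        generate G (set cs) = carrier G \<and> list_product G cs = g"
      using set S(1) generate_conj_closed[OF S(1) conj S(2)] by metis
  qed
qed

text \<open>Commutators form a conjugation-closed set, which is nontrivial because \<open>G\<close>
  is not commutative, so the covering result applies to them.\<close>

lemma eventually_generating_commutator_pairs:
  assumes fin: "finite (carrier G)" and ncomm: "\<not> comm_group G"
  shows "\<forall>\<^sub>F h in sequentially. \<forall>g\<in>carrier G. \<exists>abps. length abps = h \<and>
    set abps \<subseteq> carrier G \<times> carrier G \<and> generate G (fst ` set abps) = carrier G \<and>
    list_product G (map (\<lambda>(a, b). commutator G a b) abps) = g"
proof -
  define S where "S = (\<lambda>(a, b). commutator G a b) ` (carrier G \<times> carrier G)"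
  have S: "S \<subseteq> carrier G"
    by (auto simp: S_def)
  have nontrivial: "\<not> S \<subseteq> {\<one>}"
  proof
    assume "S \<subseteq> {\<one>}"
    then have "commutator G a b = \<one>" if "a \<in> carrier G" "b \<in> carrier G" for a b
      using that unfolding S_def by auto
    then show False
      using ncomm group_comm_groupI commutator_eq_oneD by metis
  qed
  have conj: "g \<otimes> x \<otimes> inv g \<in> S" if x: "x \<in> S" and g: "g \<in> carrier G" for x g
  proof -
    obtain a b where ab: "x = commutator G a b" "a \<in> carrier G" "b \<in> carrier G"
      using x by (auto simp: S_def)
    have "g \<otimes> x \<otimes> inv g = commutator G (g \<otimes> a \<otimes> inv g) (g \<otimes> b \<otimes> inv g)"
      using ab g by (simp only: conj_commutator)
    then show ?thesis
      unfolding S_def using ab(2,3) g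
      by (intro image_eqI[of _ _ "(g \<otimes> a \<otimes> inv g, g \<otimes> b \<otimes> inv g)"]) simp_all
  qed
  obtain k where k: "\<And>t g. t \<ge> k \<Longrightarrow> g \<in> carrier G \<Longrightarrow>
      \<exists>xs. length xs = t \<and> set xs \<subseteq> S \<and> list_product G xs = g"
    using eventually_conj_closed_cover[OF fin ncomm S conj nontrivial]
    unfolding eventually_sequentially by blast
  obtain zs where zs: "set zs = carrier G"
    using finite_list[OF fin] by blast
  show ?thesis
    using eventually_ge_at_top[of "length zs + k"]
  proof (eventually_elim, intro ballI)
    fix h g assume h: "length zs + k \<le> h" and g: "g \<in> carrier G"
    have "k \<le> h - length zs"
      using h by simp
    then obtain xs where xs: "length xs = h - length zs" "set xs \<subseteq> S" "list_product G xs = g"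
      using k g by blast
    have "xs \<in> lists S"
      using xs(2) by auto
    then obtain ps where ps: "set ps \<subseteq> carrier G \<times> carrier G"
        "xs = map (\<lambda>(a, b). commutator G a b) ps"
      unfolding S_def lists_image by auto
    \<comment> \<open>The pairs \<open>(a, \<one>)\<close> have trivial commutators, so they bring
      all of \<open>G\<close> into the first components without changing the product.\<close>
    define abps where "abps = map (\<lambda>a. (a, \<one>)) zs @ ps"
    have "map (\<lambda>(a, b). commutator G a b) abps = replicate (length zs) \<one> @ xs"
      using zs by (auto simp: abps_def ps(2) commutator_one_right intro!: replicate_eqI)
    then have "list_product G (map (\<lambda>(a, b). commutator G a b) abps) = g"
      using xs S list_product_replicate_one_append[of xs] by auto
    moreover have set: "set abps \<subseteq> carrier G \<times> carrier G" "fst ` set abps = carrier G"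
      using ps(1) zs by (force simp: abps_def)+
    moreover have "generate G (carrier G) = carrier G"
      using generate_incl[of "carrier G"] by (auto intro: generate.incl)
    moreover have "length abps = h"
      using h xs(1) ps(2) by (simp add: abps_def)
    ultimately show "\<exists>abps. length abps = h \<and>
        set abps \<subseteq> carrier G \<times> carrier G \<and> generate G (fst ` set abps) = carrier G \<and>
        list_product G (map (\<lambda>(a, b). commutator G a b) abps) = g"
      by (intro exI[of _ abps]) auto
  qed
qed

end

section \<open>Assembling generating vectors\<close>

context group
begin

lemma generate_eq_carrier_mono:
  assumes "generate G K = carrier G" "K \<subseteq> H" "H \<subseteq> carrier G"
  shows "generate G H = carrier G"
  using mono_generate[OF assms(2)] generate_incl[OF assms(3)] assms(1) by blast

lemma ex_elements_of_orders:
  assumes "set ms \<subseteq> order_set G"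
  shows "\<exists>cs. set cs \<subseteq> carrier G \<and> map ord cs = ms"
proof -
  have "ms \<in> lists (ord ` carrier G)"
    using assms by (auto simp: order_set_def)
  then show ?thesis
    unfolding lists_image by auto
qed

text \<open>The disjunction reflects the two sources of generation: the commutator pairs when
  \<open>h\<close> is large, the tail when some multiplicity is large.\<close>

lemma generating_vectorI:
  assumes "length abps = h" "map ord cs = ms"
    and "set abps \<subseteq> carrier G \<times> carrier G" "set cs \<subseteq> carrier G"
    and "generate G (fst ` set abps) = carrier G \<or> generate G (set cs) = carrier G"
    and "list_product G (map (\<lambda>(a, b). commutator G a b) abps) \<otimes> list_product G cs = \<one>"
  shows "generating_vector G (h, ms) abps cs"
proof -
  let ?X = "fst ` set abps \<union> snd ` set abps \<union> set cs"
  have "?X \<subseteq> carrier G"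
    using assms(3,4) by auto
  then have "generate G ?X = carrier G"
    using assms(5) generate_eq_carrier_mono[of "fst ` set abps" ?X]
      generate_eq_carrier_mono[of "set cs" ?X] by blast
  then show ?thesis
    using assms(1-4,6) by (auto simp: generating_vector_def)
qed

end

lemma set_signature_tail:
  assumes "finite (carrier G)"
  shows "set (signature_tail G ts) \<subseteq> order_set G"
proof -
  have "set (order_list G) = order_set G"
    using assms by (simp add: order_list_def order_set_def)
  then show ?thesis
    by (auto simp: signature_tail_def dest!: set_zip_leftD)
qed

text \<open>Equal orders form one contiguous block of the tail. Isolating it allows a large block to
  be filled last, after the entries on both sides have been chosen.\<close>

lemma signature_tail_split:
  assumes "finite (carrier G)" "length ts = length (order_list G)" "t \<in> set ts"
  shows "\<exists>n as bs. n \<in> order_set G \<and> signature_tail G ts = as @ replicate t n @ bs"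
proof -
  obtain i where i: "i < length ts" "t = ts ! i"
    using assms(3) by (metis in_set_conv_nth)
  let ?xs = "map2 (\<lambda>n t. replicate t n) (order_list G) ts"
  have "?xs ! i = replicate t (order_list G ! i)"
    using i assms(2) by simp
  then have "?xs = take i ?xs @ replicate t (order_list G ! i) # drop (Suc i) ?xs"
    using i assms(2) by (metis (no_types, lifting) id_take_nth_drop length_map length_zip min.idem)
  then have "signature_tail G ts =
      concat (take i ?xs) @ replicate t (order_list G ! i) @ concat (drop (Suc i) ?xs)"
    unfolding signature_tail_def by (metis concat.simps(2) concat_append)
  moreover have "order_list G ! i \<in> order_set G"
    using nth_mem[of i "order_list G"] i assms by (simp add: order_list_def order_set_def)
  ultimately show ?thesis by blast
qed

text \<open>A potential signature that is not actual must have \<open>h\<close> and every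
  multiplicity below a common bound \<open>N\<close>. The number of multiplicities is fixed, so only
  finitely many such signatures exist.\<close>

lemma (in simple_group) AAS_if_finite_nonabelian:
  assumes fin: "finite (carrier G)" and ncomm: "\<not> comm_group G"
  shows "AAS G"
proof -
  have "finite (order_set G)"
    using fin by (simp add: order_set_def)
  then have "\<forall>\<^sub>F t in sequentially. \<forall>n\<in>order_set G. \<forall>g\<in>carrier G. \<exists>cs. set cs \<subseteq> carrier G \<and>
      map ord cs = replicate t n \<and> generate G (set cs) = carrier G \<and> list_product G cs = g"
    using eventually_generating_elements_of_order[OF fin ncomm]
    by (simp add: eventually_ball_finite)
  from eventually_conj[OF eventually_generating_commutator_pairs[OF fin ncomm] this]
  obtain N where N1: "\<And>h g. h \<ge> N \<Longrightarrow> g \<in> carrier G \<Longrightarrow> \<exists>abps. length abps = h \<and>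
      set abps \<subseteq> carrier G \<times> carrier G \<and> generate G (fst ` set abps) = carrier G \<and>
      list_product G (map (\<lambda>(a, b). commutator G a b) abps) = g"
    and N2: "\<And>t n g. t \<ge> N \<Longrightarrow> n \<in> order_set G \<Longrightarrow> g \<in> carrier G \<Longrightarrow> \<exists>cs. set cs \<subseteq> carrier G \<and>
      map ord cs = replicate t n \<and> generate G (set cs) = carrier G \<and> list_product G cs = g"
    unfolding eventually_sequentially by blast
  \<comment> \<open>The tail is filled with any elements of the right orders; the commutator pairs
    supply both generation and the inverse of the tail's product.\<close>
  have large_h: "\<exists>abps cs. generating_vector G (h, signature_tail G ts) abps cs" if "h \<ge> N" for h ts
  proof -
    obtain cs where cs: "set cs \<subseteq> carrier G" "map ord cs = signature_tail G ts"
      using ex_elements_of_orders[OF set_signature_tail[OF fin]] by blast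
    from N1[OF that, of "inv (list_product G cs)"] cs
    obtain abps where "length abps = h" "set abps \<subseteq> carrier G \<times> carrier G"
      "generate G (fst ` set abps) = carrier G"
      "list_product G (map (\<lambda>(a, b). commutator G a b) abps) = inv (list_product G cs)"
      by auto
    with cs show ?thesis
      by (intro exI[of _ abps] exI[of _ cs] generating_vectorI) auto
  qed
  have large_t: "\<exists>abps cs. generating_vector G (h, signature_tail G ts) abps cs"
    if len: "length ts = length (order_list G)" and t: "t \<in> set ts" "t \<ge> N" for h t ts
  proof -
    obtain n as bs where n: "n \<in> order_set G" and split: "signature_tail G ts = as @ replicate t n @ bs"
      using signature_tail_split[OF fin len t(1)] by blast
    have "set as \<subseteq> order_set G" "set bs \<subseteq> order_set G"
      using set_signature_tail[OF fin, of ts] split by auto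
    then obtain xs ys where xs: "set xs \<subseteq> carrier G" "map ord xs = as"
      and ys: "set ys \<subseteq> carrier G" "map ord ys = bs"
      using ex_elements_of_orders by meson
    \<comment> \<open>The block sits between \<open>xs\<close> and \<open>ys\<close>, so its product
      must be the inverse of the left one times the inverse of the right one.\<close>
    from N2[OF t(2) n, of "inv (list_product G xs) \<otimes> inv (list_product G ys)"] xs ys
    obtain cs where cs: "set cs \<subseteq> carrier G" "map ord cs = replicate t n"
      "generate G (set cs) = carrier G"
      "list_product G cs = inv (list_product G xs) \<otimes> inv (list_product G ys)"
      by auto
    have "list_product G (xs @ cs @ ys) = list_product G xs \<otimes> list_product G cs \<otimes> list_product G ys"
      using xs ys cs by (simp add: list_product_append m_assoc)
    also have "\<dots> = \<one>"
      using xs ys by (simp add: cs(4) m_assoc[symmetric])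
    finally have "list_product G (xs @ cs @ ys) = \<one>" .
    moreover have "generate G (set (xs @ cs @ ys)) = carrier G"
      by (rule generate_eq_carrier_mono[OF cs(3)]) (use xs ys cs in auto)
    \<comment> \<open>Identity pairs occupy the \<open>h\<close> commutator positions and contribute
      nothing to the product.\<close>
    moreover have "list_product G (map (\<lambda>(a, b). commutator G a b) (replicate h (\<one>, \<one>))) = \<one>"
      by (simp add: list_product_replicate commutator_one_right)
    ultimately show ?thesis
      using xs ys cs split
      by (intro exI[of _ "replicate h (\<one>, \<one>)"] exI[of _ "xs @ cs @ ys"] generating_vectorI) auto
  qed
  have "potential_signatures G - actual_signatures G \<subseteq>
      {..<N} \<times> signature_tail G ` {ts. set ts \<subseteq> {..<N} \<and> length ts = length (order_list G)}"
    (is "_ \<subseteq> ?F")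
  proof
    fix \<sigma> assume \<sigma>: "\<sigma> \<in> potential_signatures G - actual_signatures G"
    then obtain h ts where ts: "\<sigma> = (h, signature_tail G ts)" "length ts = length (order_list G)"
      unfolding potential_signatures_def by blast
    then have "\<nexists>abps cs. generating_vector G (h, signature_tail G ts) abps cs"
      using \<sigma> by (auto simp: actual_signatures_def)
    then have "h < N" "set ts \<subseteq> {..<N}"
      using large_h[of h ts] large_t[OF ts(2), of _ h] by (auto simp: not_le[symmetric])
    then show "\<sigma> \<in> ?F"
      using ts by auto
  qed
  moreover have "finite ?F"
    by (intro finite_cartesian_product finite_imageI finite_lists_length_eq) auto
  ultimately show ?thesis
    unfolding AAS_def by (rule finite_subset)
qed

theorem theorem4p4:
  fixes G :: "('a, 'b) monoid_scheme"
  assumes "simple_group G"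
    and "finite (carrier G)"
    and "\<not> comm_group G"
  shows "AAS G"
  using assms by (rule simple_group.AAS_if_finite_nonabelian)

end
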